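(* Let $(\mathscr{C}_I,\tau)$ be a Hausdorff locally compact semitopological semigroup such that $\mathscr{C}_I=\mathscr{C}(p,q)\sqcup I$ (the disjoint union of a subsemigroup which is the bicyclic monoid $\mathscr{C}(p,q)$ and a set $I$), where $I$ is a compact ideal of $\mathscr{C}_I$. Then either $(\mathscr{C}_I,\tau)$ is a compact semitopological semigroup or the ideal $I$ is open in $(\mathscr{C}_I,\tau)$.
   Context: The bicyclic monoid $\mathscr{C}(p,q)$ is the monoid with identity $1$ generated by two elements $p,q$ subject to the single relation $pq=1$; its elements are exactly the pairwise distinct elements $q^ip^j$, $i,j\geq 0$. A semitopological semigroup is a semigroup with a topology for which the multiplication is separately continuous. A space is locally compact if every point has an open neighbourhood with compact closure. Ideal means two-sided ideal. *)

theory Defs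
  imports "HOL-Analysis.Analysis"
begin

text \<open>The monoid presentation \<open>\<langle>p, q | pq = 1\<rangle>\<close>: words in two letters modulo the least
  congruence that identifies the word \<open>pq\<close> with the empty word.\<close>

datatype bicyclic_gen = Gen_p | Gen_q

inductive bicyclic_cong :: "bicyclic_gen list \<Rightarrow> bicyclic_gen list \<Rightarrow> bool" where
  rel: "bicyclic_cong [Gen_p, Gen_q] []"
| refl: "bicyclic_cong u u"
| sym: "bicyclic_cong u v \<Longrightarrow> bicyclic_cong v u"
| trans: "bicyclic_cong u v \<Longrightarrow> bicyclic_cong v w \<Longrightarrow> bicyclic_cong u w"
| append: "bicyclic_cong u u' \<Longrightarrow> bicyclic_cong v v' \<Longrightarrow> bicyclic_cong (u @ v) (u' @ v')"

quotient_type bicyclic = "bicyclic_gen list" / bicyclic_cong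
  by (intro equivpI reflpI sympI transpI)
     (blast intro: bicyclic_cong.refl bicyclic_cong.sym bicyclic_cong.trans)+

instantiation bicyclic :: monoid_mult
begin

lift_definition one_bicyclic :: bicyclic is "[]" .

lift_definition times_bicyclic :: "bicyclic \<Rightarrow> bicyclic \<Rightarrow> bicyclic" is "(@)"
  by (rule bicyclic_cong.append)

instance
  by standard (transfer, simp add: bicyclic_cong.refl)+

end

text \<open>Closure of \<open>C\<close> under multiplication is part of the definition, since \<open>f\<close> has image \<open>C\<close>.
  The identity of \<open>C\<close> is not required to be an identity of the ambient semigroup.\<close>

definition bicyclic_subsemigroup :: "'a::semigroup_mult set \<Rightarrow> bool" where
  "bicyclic_subsemigroup C \<longleftrightarrow>
     (\<exists>f :: bicyclic \<Rightarrow> 'a. bij_betw f UNIV C \<and> (\<forall>x y. f (x * y) = f x * f y))"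

text \<open>Two-sided ideals; the empty set is allowed.\<close>

definition semigroup_ideal :: "'a::semigroup_mult set \<Rightarrow> bool" where
  "semigroup_ideal I \<longleftrightarrow> (\<forall>s. \<forall>x\<in>I. s * x \<in> I \<and> x * s \<in> I)"

definition semitopological_semigroup :: "'a::semigroup_mult topology \<Rightarrow> bool" where
  "semitopological_semigroup \<tau> \<longleftrightarrow>
     topspace \<tau> = UNIV \<and>
     (\<forall>a. continuous_map \<tau> \<tau> (\<lambda>x. a * x) \<and> continuous_map \<tau> \<tau> (\<lambda>x. x * a))"

end

theory Submission imports Defs begin

text \<open>
  Write \<open>S = C \<union> I\<close>, and let \<open>K\<close> be a compact neighbourhood of the compact ideal \<open>I\<close>. The proof
  shows that \<open>K \<inter> C\<close> is either finite or cofinite in \<open>C\<close>. If it is finite, then removing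
  these finitely many points from an open set between \<open>I\<close> and \<open>K\<close> leaves \<open>I\<close>, which is
  thus open; if it is cofinite, then \<open>S\<close> is the union of \<open>K\<close> and a finite set, hence compact.

  Two facts give this dichotomy. The first is that compact subsets of \<open>C\<close> are finite
  (\<open>finite_compactin_bicyclic\<close>): \<open>C\<close> is open, and the fixed sets of the multiplications by the
  idempotents \<open>q\<^sup>mp\<^sup>m\<close> are closed, so \<open>C\<close> is an increasing union of the finite open boxes
  \<open>{q\<^sup>ip\<^sup>j. i < m \<and> j < m}\<close>. Consequently every translation of \<open>S\<close> moves only finitely many
  points of \<open>K\<close> out of \<open>K\<close> (\<open>finite_leaving_points\<close>): the translation maps \<open>I\<close> into itself, so by
  continuity the points of \<open>K\<close> that leave \<open>K\<close> lie in a compact set that misses \<open>I\<close>.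

  The second fact is combinatorial. In the coordinates \<open>(i, j) \<mapsto> q\<^sup>ip\<^sup>j\<close> the left translation by
  \<open>q\<close> raises the first coordinate by one, and that by \<open>p\<close> lowers it by one where it is positive; the
  right translations by \<open>p\<close> and \<open>q\<close> do the same to the second coordinate. So \<open>K \<inter> C\<close> becomes a
  set of vertices of the quadrant grid with finitely many boundary edges, and since the grid is connected outside large boxes, such a
  set is finite or cofinite (\<open>grid_finite_or_cofinite\<close>).
\<close>

section \<open>Normal forms in the bicyclic monoid\<close>

lift_definition bicyclic_p :: bicyclic is "[Gen_p]" .
lift_definition bicyclic_q :: bicyclic is "[Gen_q]" .

lemma p_mult_q: "bicyclic_p * bicyclic_q = 1"
  by transfer (simp add: bicyclic_cong.rel)

lemma p_mult_q_left: "bicyclic_p * (bicyclic_q * x) = x"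
  by (simp add: p_mult_q flip: mult.assoc)

lemma p_power_mult_q_power: "bicyclic_p ^ m * bicyclic_q ^ m = 1"
proof (induction m)
  case (Suc m)
  have "bicyclic_p ^ Suc m * bicyclic_q ^ Suc m
      = bicyclic_p ^ m * (bicyclic_p * (bicyclic_q * bicyclic_q ^ m))"
    by (simp only: power_Suc2[of bicyclic_p] power_Suc[of bicyclic_q] mult.assoc)
  then show ?case
    by (simp add: p_mult_q_left Suc)
qed simp

definition bicyclic_nf :: "nat \<Rightarrow> nat \<Rightarrow> bicyclic" where
  "bicyclic_nf i j = bicyclic_q ^ i * bicyclic_p ^ j"

lemma q_mult_nf: "bicyclic_q * bicyclic_nf i j = bicyclic_nf (Suc i) j"
  by (simp add: bicyclic_nf_def mult.assoc)

lemma p_mult_nf_Suc: "bicyclic_p * bicyclic_nf (Suc i) j = bicyclic_nf i j"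
  by (simp add: bicyclic_nf_def mult.assoc p_mult_q_left)

lemma nf_mult_p: "bicyclic_nf i j * bicyclic_p = bicyclic_nf i (Suc j)"
  by (simp add: bicyclic_nf_def mult.assoc power_commutes)

lemma nf_Suc_mult_q: "bicyclic_nf i (Suc j) * bicyclic_q = bicyclic_nf i j"
  by (simp add: p_mult_q mult.assoc flip: nf_mult_p)

lemma bicyclic_nf_exhaust: obtains i j where "x = bicyclic_nf i j"
proof -
  have "\<exists>i j. abs_bicyclic w = bicyclic_nf i j" for w
  proof (induction w)
    case Nil
    have "abs_bicyclic [] = bicyclic_nf 0 0"
      by (simp add: bicyclic_nf_def flip: one_bicyclic.abs_eq)
    then show ?case by blast
  next
    case (Cons g w)
    then obtain i j where w: "abs_bicyclic w = bicyclic_nf i j" by blast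
    have *: "abs_bicyclic (g # w) = abs_bicyclic [g] * bicyclic_nf i j"
      by (simp add: times_bicyclic.abs_eq flip: w)
    show ?case
    proof (cases g)
      case Gen_q
      then show ?thesis
        using * q_mult_nf by (auto simp: bicyclic_q.abs_eq)
    next
      case Gen_p
      then have gp: "abs_bicyclic (g # w) = bicyclic_p * bicyclic_nf i j"
        using * by (simp add: bicyclic_p.abs_eq)
      show ?thesis
      proof (cases i)
        case 0
        then have "abs_bicyclic (g # w) = bicyclic_nf 0 (Suc j)"
          by (simp add: gp bicyclic_nf_def)
        then show ?thesis by blast
      next
        case (Suc k)
        then show ?thesis using gp p_mult_nf_Suc by auto
      qed
    qed
  qed
  moreover obtain w where "x = abs_bicyclic w"
    by (metis Quotient3_abs_rep Quotient3_bicyclic)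
  ultimately show thesis
    using that by blast
qed

text \<open>
  Distinctness of the normal forms needs an invariant of the presentation. The relation \<open>pq = 1\<close> holds
  for the maps \<open>p = (\<lambda>n. n - 1)\<close> and \<open>q = Suc\<close> on \<open>\<nat>\<close>, since truncated predecessor is a left inverse of
  \<open>Suc\<close>; hence the monoid acts on \<open>\<nat>\<close> through them.
\<close>

primrec gen_act :: "bicyclic_gen \<Rightarrow> nat \<Rightarrow> nat" where
  "gen_act Gen_p n = n - 1"
| "gen_act Gen_q n = Suc n"

lift_definition bicyclic_act :: "bicyclic \<Rightarrow> nat \<Rightarrow> nat" is "foldr gen_act"
proof -
  fix u v
  show "bicyclic_cong u v \<Longrightarrow> foldr gen_act u = foldr gen_act v"
    by (induction rule: bicyclic_cong.induct) (simp_all add: fun_eq_iff)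
qed

lemma bicyclic_act_one [simp]: "bicyclic_act 1 n = n"
  by transfer simp

lemma bicyclic_act_mult [simp]: "bicyclic_act (x * y) n = bicyclic_act x (bicyclic_act y n)"
  by transfer simp

lemma bicyclic_act_p [simp]: "bicyclic_act bicyclic_p n = n - 1"
  by transfer simp

lemma bicyclic_act_q [simp]: "bicyclic_act bicyclic_q n = Suc n"
  by transfer simp

lemma bicyclic_act_nf [simp]: "bicyclic_act (bicyclic_nf i j) n = n - j + i"
proof -
  have "bicyclic_act (bicyclic_q ^ i) n = n + i" for n
    by (induction i) simp_all
  moreover have "bicyclic_act (bicyclic_p ^ j) n = n - j"
    by (induction j) simp_all
  ultimately show ?thesis
    by (simp add: bicyclic_nf_def)
qed

lemma bicyclic_nf_inject: "bicyclic_nf i j = bicyclic_nf k l \<longleftrightarrow> i = k \<and> j = l"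
proof
  assume eq: "bicyclic_nf i j = bicyclic_nf k l"
  \<comment> \<open>The value at \<open>0\<close> reads off the exponent of \<open>q\<close>. At \<open>j + l\<close> no truncation occurs on either
     side, so this value reads off the exponent of \<open>p\<close>.\<close>
  have "i = k"
    using arg_cong[OF eq, of "\<lambda>x. bicyclic_act x 0"] by simp
  moreover have "j = l"
    using arg_cong[OF eq, of "\<lambda>x. bicyclic_act x (j + l)"] \<open>i = k\<close> by simp
  ultimately show "i = k \<and> j = l" ..
qed simp

lemma idempotent_mult_nf_eq_iff:
  "bicyclic_nf m m * bicyclic_nf i j = bicyclic_nf i j \<longleftrightarrow> m \<le> i"
proof
  assume eq: "bicyclic_nf m m * bicyclic_nf i j = bicyclic_nf i j"
  show "m \<le> i"
    using arg_cong[OF eq, of "\<lambda>x. bicyclic_act x 0"] by simp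
next
  assume "m \<le> i"
  then obtain k where k: "i = m + k" by (metis le_Suc_ex)
  have "bicyclic_nf m m * bicyclic_nf i j
      = bicyclic_q ^ m * (bicyclic_p ^ m * bicyclic_q ^ m) * (bicyclic_q ^ k * bicyclic_p ^ j)"
    by (simp only: bicyclic_nf_def k power_add mult.assoc)
  then show "bicyclic_nf m m * bicyclic_nf i j = bicyclic_nf i j"
    by (simp add: p_power_mult_q_power bicyclic_nf_def k power_add mult.assoc)
qed

lemma nf_mult_idempotent_eq_iff:
  "bicyclic_nf i j * bicyclic_nf m m = bicyclic_nf i j \<longleftrightarrow> m \<le> j"
proof
  assume eq: "bicyclic_nf i j * bicyclic_nf m m = bicyclic_nf i j"
  show "m \<le> j"
    using arg_cong[OF eq, of "\<lambda>x. bicyclic_act x 0"] by simp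
next
  assume "m \<le> j"
  then obtain k where k: "j = k + m" by (metis le_Suc_ex add.commute)
  have "bicyclic_nf i j * bicyclic_nf m m
      = (bicyclic_q ^ i * bicyclic_p ^ k) * (bicyclic_p ^ m * bicyclic_q ^ m) * bicyclic_p ^ m"
    by (simp only: bicyclic_nf_def k power_add mult.assoc)
  then show "bicyclic_nf i j * bicyclic_nf m m = bicyclic_nf i j"
    by (simp add: p_power_mult_q_power bicyclic_nf_def k power_add mult.assoc)
qed

section \<open>Sets with finite edge boundary in the quadrant grid\<close>

text \<open>
  The quadrant grid has one end: once all boundary edges lie in the box \<open>{..<n} \<times> {..<n}\<close>, any vertex
  outside that box is joined to the corner \<open>(n, n)\<close> by a path that avoids the box, and membership in
  \<open>A\<close> is constant along the path.
\<close>

lemma grid_finite_or_cofinite: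
  fixes A :: "(nat \<times> nat) set"
  assumes fin1: "finite {(i, j). (i, j) \<in> A \<longleftrightarrow> (Suc i, j) \<notin> A}"
    and fin2: "finite {(i, j). (i, j) \<in> A \<longleftrightarrow> (i, Suc j) \<notin> A}"
  shows "finite A \<or> finite (- A)"
proof -
  define B where "B = {(i, j). (i, j) \<in> A \<longleftrightarrow> (Suc i, j) \<notin> A}
    \<union> {(i, j). (i, j) \<in> A \<longleftrightarrow> (i, Suc j) \<notin> A}"
  have "finite (fst ` B \<union> snd ` B)"
    using fin1 fin2 by (simp add: B_def)
  then obtain n where n: "\<forall>k \<in> fst ` B \<union> snd ` B. k < n"
    by (meson finite_nat_set_iff_bounded)
  have not_B: "(i, j) \<notin> B" if "n \<le> i \<or> n \<le> j" for i j
  proof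
    assume "(i, j) \<in> B"
    then have "i < n" "j < n"
      using n by (metis UnI1 fst_conv image_eqI, metis UnI2 snd_conv image_eqI)
    then show False using that by simp
  qed
  have step1: "(i, j) \<in> A \<longleftrightarrow> (Suc i, j) \<in> A" if "n \<le> i \<or> n \<le> j" for i j
    using not_B[OF that] by (simp add: B_def)
  have step2: "(i, j) \<in> A \<longleftrightarrow> (i, Suc j) \<in> A" if "n \<le> i \<or> n \<le> j" for i j
    using not_B[OF that] by (auto simp: B_def)
  have move1: "(i, j) \<in> A \<longleftrightarrow> (0, j) \<in> A" if "n \<le> j" for i j
  proof (induction i)
    case (Suc i)
    have "(i, j) \<in> A \<longleftrightarrow> (Suc i, j) \<in> A"
      using that by (intro step1) simp
    then show ?case using Suc by (rule subst)
  qed (rule HOL.refl)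
  have move2: "(i, j) \<in> A \<longleftrightarrow> (i, 0) \<in> A" if "n \<le> i" for i j
  proof (induction j)
    case (Suc j)
    have "(i, j) \<in> A \<longleftrightarrow> (i, Suc j) \<in> A"
      using that by (intro step2) simp
    then show ?case using Suc by (rule subst)
  qed (rule HOL.refl)
  have outside: "(i, j) \<in> A \<longleftrightarrow> (n, n) \<in> A" if "n \<le> i \<or> n \<le> j" for i j
    using that
  proof
    assume "n \<le> i"
    have "(i, j) \<in> A \<longleftrightarrow> (i, 0) \<in> A" by (rule move2[OF \<open>n \<le> i\<close>])
    also have "\<dots> \<longleftrightarrow> (i, n) \<in> A" by (rule move2[OF \<open>n \<le> i\<close>, symmetric])
    also have "\<dots> \<longleftrightarrow> (0, n) \<in> A" by (rule move1) simp
    also have "\<dots> \<longleftrightarrow> (n, n) \<in> A" by (rule move1[symmetric]) simp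
    finally show ?thesis .
  next
    assume "n \<le> j"
    have "(i, j) \<in> A \<longleftrightarrow> (0, j) \<in> A" by (rule move1[OF \<open>n \<le> j\<close>])
    also have "\<dots> \<longleftrightarrow> (n, j) \<in> A" by (rule move1[OF \<open>n \<le> j\<close>, symmetric])
    also have "\<dots> \<longleftrightarrow> (n, 0) \<in> A" by (rule move2) simp
    also have "\<dots> \<longleftrightarrow> (n, n) \<in> A" by (rule move2[symmetric]) simp
    finally show ?thesis .
  qed
  have in_box: "x \<in> {..<n} \<times> {..<n}" if "x \<in> A \<longleftrightarrow> (n, n) \<notin> A" for x
  proof -
    have "\<not> (n \<le> fst x \<or> n \<le> snd x)"
      using outside[of "fst x" "snd x", unfolded prod.collapse] that by blast
    then show ?thesis by (simp add: mem_Times_iff)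
  qed
  show ?thesis
  proof (cases "(n, n) \<in> A")
    case True
    then have "- A \<subseteq> {..<n} \<times> {..<n}"
      by (intro subsetI in_box) simp
    then show ?thesis
      using finite_subset[of "- A" "{..<n} \<times> {..<n}"] by simp
  next
    case False
    then have "A \<subseteq> {..<n} \<times> {..<n}"
      by (intro subsetI in_box) simp
    then show ?thesis
      using finite_subset[of A "{..<n} \<times> {..<n}"] by simp
  qed
qed

section \<open>Compact sets and translations\<close>

text \<open>
  This is the form in which discreteness of Hausdorff semitopological bicyclic monoids enters. The
  complement in \<open>C\<close> of the fixed sets of \<open>x \<mapsto> q\<^sup>mp\<^sup>m x\<close> and \<open>x \<mapsto> x q\<^sup>mp\<^sup>m\<close> is open and consists of
  the \<open>q\<^sup>ip\<^sup>j\<close> with \<open>i, j < m\<close>; these finite sets increase to \<open>C\<close>.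
\<close>

lemma finite_compactin_bicyclic:
  fixes f :: "bicyclic \<Rightarrow> 'a::semigroup_mult"
  assumes semitop: "semitopological_semigroup \<tau>"
    and haus: "Hausdorff_space \<tau>"
    and inj: "inj f"
    and hom: "\<And>x y. f (x * y) = f x * f y"
    and op: "openin \<tau> (range f)"
    and comp: "compactin \<tau> L"
    and sub: "L \<subseteq> range f"
  shows "finite L"
proof -
  have top: "topspace \<tau> = UNIV"
    using semitop by (simp add: semitopological_semigroup_def)
  define e where "e m = f (bicyclic_nf m m)" for m
  define Box where "Box m = range f - {x. e m * x = x} - {x. x * e m = x}" for m
  have mem_Box: "f (bicyclic_nf i j) \<in> Box m \<longleftrightarrow> i < m \<and> j < m" for i j m
    by (auto simp: Box_def e_def idempotent_mult_nf_eq_iff nf_mult_idempotent_eq_iff inj_eq[OF inj]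
        simp flip: hom)
  have open_Box: "openin \<tau> (Box m)" for m
  proof -
    have "closedin \<tau> {x \<in> topspace \<tau>. e m * x = x}" "closedin \<tau> {x \<in> topspace \<tau>. x * e m = x}"
      using semitop unfolding semitopological_semigroup_def
      by (intro closedin_continuous_maps_eq[OF haus]; simp)+
    then show ?thesis
      unfolding Box_def using op by (auto simp: top intro!: openin_diff)
  qed
  have finite_Box: "finite (Box m)" for m
  proof -
    have "Box m \<subseteq> (\<lambda>(i, j). f (bicyclic_nf i j)) ` ({..<m} \<times> {..<m})"
    proof
      fix x assume x: "x \<in> Box m"
      then obtain y where "x = f y"
        by (auto simp: Box_def)
      moreover obtain i j where "y = bicyclic_nf i j"
        by (rule bicyclic_nf_exhaust)
      ultimately show "x \<in> (\<lambda>(i, j). f (bicyclic_nf i j)) ` ({..<m} \<times> {..<m})"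
        using x mem_Box by auto
    qed
    then show ?thesis
      by (rule finite_subset) simp
  qed
  have "L \<subseteq> \<Union> (range Box)"
  proof
    fix x assume "x \<in> L"
    then obtain y where "x = f y"
      using sub by blast
    moreover obtain i j where "y = bicyclic_nf i j"
      by (rule bicyclic_nf_exhaust)
    ultimately have "x \<in> Box (Suc (max i j))"
      using mem_Box by (simp add: less_Suc_eq_le)
    then show "x \<in> \<Union> (range Box)" by blast
  qed
  then obtain \<F> where F: "finite \<F>" "\<F> \<subseteq> range Box" "L \<subseteq> \<Union> \<F>"
    using compactinD[OF comp, of "range Box"] open_Box by blast
  then have "finite (\<Union> \<F>)"
    using finite_Box by (intro finite_Union) auto
  then show ?thesis
    using F(3) by (rule finite_subset[rotated])
qed

text \<open>
  The points of \<open>K\<close> that are not mapped into \<open>U\<close> form a closed subset of \<open>K\<close>, so a compact set, and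
  this set misses \<open>I\<close>.
\<close>

lemma finite_leaving_points:
  assumes cont: "continuous_map \<tau> \<tau> g"
    and inv: "g ` I \<subseteq> I"
    and U: "openin \<tau> U" "I \<subseteq> U" "U \<subseteq> K"
    and K: "compactin \<tau> K"
    and fin: "\<And>L. compactin \<tau> L \<Longrightarrow> L \<inter> I = {} \<Longrightarrow> finite L"
  shows "finite {x \<in> K. g x \<notin> K}"
proof -
  let ?V = "{x \<in> topspace \<tau>. g x \<in> U}"
  have "openin \<tau> ?V"
    using cont U(1) by (rule openin_continuous_map_preimage)
  then have "compactin \<tau> (K \<inter> (topspace \<tau> - ?V))"
    using K by (intro compact_Int_closedin) auto
  moreover have "K \<inter> (topspace \<tau> - ?V) \<inter> I = {}"
    using inv U(2) by auto
  ultimately have "finite (K \<inter> (topspace \<tau> - ?V))"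
    by (rule fin)
  moreover have "{x \<in> K. g x \<notin> K} \<subseteq> K \<inter> (topspace \<tau> - ?V)"
    using U(3) compactin_subset_topspace[OF K] by auto
  ultimately show ?thesis
    by (rule finite_subset[rotated])
qed

section \<open>The dichotomy\<close>

theorem theorem3p2:
  fixes \<tau> :: "'a::semigroup_mult topology" and C I :: "'a set"
  assumes "semitopological_semigroup \<tau>"
    and "Hausdorff_space \<tau>"
    and "locally_compact_space \<tau>"
    and "bicyclic_subsemigroup C"
    and "semigroup_ideal I"
    and "compactin \<tau> I"
    and "C \<union> I = UNIV"
    and "C \<inter> I = {}"
  shows "(compact_space \<tau> \<and> semitopological_semigroup \<tau>) \<or> openin \<tau> I"
proof -
  have top: "topspace \<tau> = UNIV"
    and contL: "continuous_map \<tau> \<tau> (\<lambda>x. a * x)" and contR: "continuous_map \<tau> \<tau> (\<lambda>x. x * a)" for a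
    using assms(1) by (auto simp: semitopological_semigroup_def)
  obtain f :: "bicyclic \<Rightarrow> 'a" where bij: "bij_betw f UNIV C" and hom: "\<And>x y. f (x * y) = f x * f y"
    using assms(4) by (auto simp: bicyclic_subsemigroup_def)
  have inj: "inj f" and ran: "range f = C"
    using bij by (auto simp: bij_betw_def)
  have C_eq: "C = topspace \<tau> - I"
    using assms(7,8) top by blast
  have "openin \<tau> C"
    unfolding C_eq using compactin_imp_closedin[OF assms(2,6)] by blast
  then have fin: "finite L" if "compactin \<tau> L" "L \<inter> I = {}" for L
    using finite_compactin_bicyclic[OF assms(1,2) inj hom _ that(1)] that(2) ran assms(7) by blast
  obtain U K where UK: "openin \<tau> U" "compactin \<tau> K" "I \<subseteq> U" "U \<subseteq> K"
    using assms(2,3,6) locally_compact_space_compact_closed_compact by metis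
  have finL: "finite {x \<in> K. a * x \<notin> K}" for a
    by (rule finite_leaving_points[OF contL _ UK(1,3,4,2) fin])
       (use assms(5) in \<open>auto simp: semigroup_ideal_def\<close>)
  have finR: "finite {x \<in> K. x * a \<notin> K}" for a
    by (rule finite_leaving_points[OF contR _ UK(1,3,4,2) fin])
       (use assms(5) in \<open>auto simp: semigroup_ideal_def\<close>)

  define h where "h = (\<lambda>(i, j). f (bicyclic_nf i j))"
  have h_inj: "inj h"
    by (auto simp: h_def inj_on_def inj_eq[OF inj] bicyclic_nf_inject)
  have h_ran: "range h = C"
  proof -
    have "f x \<in> range h" for x
      by (rule bicyclic_nf_exhaust[of x]) (auto simp: h_def image_iff)
    then show ?thesis
      using ran by (auto simp: h_def)
  qed
  define A where "A = h -` K"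
  have edge1: "h (Suc i, j) = f bicyclic_q * h (i, j)" "h (i, j) = f bicyclic_p * h (Suc i, j)" for i j
    by (simp_all add: h_def q_mult_nf p_mult_nf_Suc flip: hom)
  have edge2: "h (i, Suc j) = h (i, j) * f bicyclic_p" "h (i, j) = h (i, Suc j) * f bicyclic_q" for i j
    by (simp_all add: h_def nf_mult_p nf_Suc_mult_q flip: hom)
  \<comment> \<open>If the lower end of a boundary edge lies in \<open>A\<close>, then the generator that raises the coordinate
     moves it out of \<open>K\<close>; if the upper end lies in \<open>A\<close>, the generator that lowers the coordinate does.\<close>
  have "{(i, j). (i, j) \<in> A \<longleftrightarrow> (Suc i, j) \<notin> A}
      \<subseteq> h -` {x \<in> K. f bicyclic_q * x \<notin> K}
        \<union> (\<lambda>(i, j). h (Suc i, j)) -` {x \<in> K. f bicyclic_p * x \<notin> K}"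
    by (auto simp: A_def simp flip: edge1)
  moreover have "inj (\<lambda>(i, j). h (Suc i, j))"
    using h_inj by (auto simp: inj_on_def)
  ultimately have "finite {(i, j). (i, j) \<in> A \<longleftrightarrow> (Suc i, j) \<notin> A}"
    using finL h_inj by (meson finite_UnI finite_subset finite_vimageI)
  moreover have "finite {(i, j). (i, j) \<in> A \<longleftrightarrow> (i, Suc j) \<notin> A}"
  proof -
    have "{(i, j). (i, j) \<in> A \<longleftrightarrow> (i, Suc j) \<notin> A}
        \<subseteq> h -` {x \<in> K. x * f bicyclic_p \<notin> K}
          \<union> (\<lambda>(i, j). h (i, Suc j)) -` {x \<in> K. x * f bicyclic_q \<notin> K}"
      by (auto simp: A_def simp flip: edge2)
    moreover have "inj (\<lambda>(i, j). h (i, Suc j))"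
      using h_inj by (auto simp: inj_on_def)
    ultimately show ?thesis
      using finR h_inj by (meson finite_UnI finite_subset finite_vimageI)
  qed
  ultimately have "finite A \<or> finite (- A)"
    by (rule grid_finite_or_cofinite)
  then show ?thesis
  proof
    assume "finite A"
    moreover have "K \<inter> C = h ` A"
      using h_ran by (auto simp: A_def)
    ultimately have "finite (K \<inter> C)" by simp
    then have "closedin \<tau> (K \<inter> C)"
      using Hausdorff_imp_t1_space[OF assms(2)] top t1_space_closedin_finite
      by (metis subset_UNIV)
    moreover have "I = U - K \<inter> C"
      using UK(3,4) assms(7,8) by blast
    ultimately show ?thesis
      using UK(1) openin_diff by metis
  next
    assume "finite (- A)"
    moreover have "- K \<subseteq> h ` (- A)"
      using h_ran assms(7) UK(3,4) by (fastforce simp: A_def)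
    ultimately have "finite (- K)"
      using finite_surj by blast
    then have "compactin \<tau> (K \<union> - K)"
      using UK(2) top by (intro compactin_Un[OF _ finite_imp_compactin]) auto
    then show ?thesis
      using assms(1) top by (simp add: compact_space_def)
  qed
qed

end
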